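(* Let $0<\alpha<1$, $0<\beta<1$ and $g\in H_\alpha([0,1])$. Then the integral $\int_a^b f(t)\,dg(t)$, $0\le a<b\le1$, exists for every function $f\in H_\beta([0,1])$ if and only if $$\sum_{k=1}^{\infty}2^{k(1-\beta)}|B_{k-1}(g)|<\infty .$$
   Context: For $0<\beta\le1$, $H_\beta([0,1])$ is the class of functions with finite seminorm $|f,H_\beta([0,1])|=\sup_{s\ne t\in[0,1]}|f(s)-f(t)|/|s-t|^\beta$. For $g\in C([0,1])$ put $t_{k,n}=n2^{-k}$ and $h_{k,n}=h_{k,n}(g)=2^k\int_{t_{k,n}}^{t_{k,n+1}}g(\tau)\,d\tau$ for $k\ge0$, $0\le n<2^k$. For $0\le a<b\le1$ and $k\ge1$ let $n_k(a)$ and $n_k(b)$ be the smallest and the largest element of the set of consecutive integers $\{n:\ 0\le n\le 2^k,\ [t_{k-1,\lfloor n/2\rfloor},t_{k-1,\lfloor n/2\rfloor+1}]\subset[a,b]\}$ (if this set is empty, the sum below is $0$). By definition, $$\int_a^b f(t)\,dg(t)=\lim_{k\to\infty}\sum_{n=n_k(a)+1}^{n_k(b)}f(t_{k,n})\,(h_{k,n}-h_{k,n-1}),$$ and the integral exists if this limit exists (finite). $|B_k(g)|$ is the (unsigned) area between the polygonal step curves with heights $h_{k,n}(g)$ and $h_{k+1,n}(g)$ over the dyadic intervals of levels $k$ and $k+1$ of $[0,1]$, i.e. $|B_k(g)|=2^{-(k+1)}\sum_{n=0}^{2^k-1}|h_{k+1,2n+1}(g)-h_{k+1,2n}(g)|$,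 $k\ge0$. *)

theory Defs
  imports "HOL-Analysis.Analysis"
begin

text \<open>Functions on the unit interval are total functions \<^typ>\<open>real \<Rightarrow> real\<close>; every
  definition below only depends on their values on \<^term>\<open>{0..1::real}\<close>.\<close>

definition holder_seminorm :: "real \<Rightarrow> (real \<Rightarrow> real) \<Rightarrow> ereal" where
  "holder_seminorm \<beta> f =
     (SUP (s, t) \<in> {(s, t). s \<in> {0..1} \<and> t \<in> {0..1} \<and> s \<noteq> t}.
        ereal (\<bar>f s - f t\<bar> / \<bar>s - t\<bar> powr \<beta>))"

definition holder_class :: "real \<Rightarrow> (real \<Rightarrow> real) set" where
  "holder_class \<beta> = {f. holder_seminorm \<beta> f < \<infinity>}"

definition dyadic_point :: "nat \<Rightarrow> nat \<Rightarrow> real" where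
  "dyadic_point k n = real n / 2 ^ k"

definition dyadic_mean :: "(real \<Rightarrow> real) \<Rightarrow> nat \<Rightarrow> nat \<Rightarrow> real" where
  "dyadic_mean g k n = 2 ^ k * integral {dyadic_point k n .. dyadic_point k (n + 1)} g"

text \<open>In the next two definitions only \<^prop>\<open>k \<ge> 1\<close> is meaningful; the value at \<^term>\<open>0::nat\<close>,
  where \<^term>\<open>k - 1\<close> is truncated, does not affect the limit.\<close>

definition dyadic_indices :: "real \<Rightarrow> real \<Rightarrow> nat \<Rightarrow> nat set" where
  "dyadic_indices a b k =
     {n. n \<le> 2 ^ k \<and>
         {dyadic_point (k - 1) (n div 2) .. dyadic_point (k - 1) (n div 2 + 1)} \<subseteq> {a..b}}"

definition dyadic_sum ::
  "(real \<Rightarrow> real) \<Rightarrow> (real \<Rightarrow> real) \<Rightarrow> real \<Rightarrow> real \<Rightarrow> nat \<Rightarrow> real" where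
  "dyadic_sum f g a b k =
     (if dyadic_indices a b k = {} then 0
      else \<Sum>n = Min (dyadic_indices a b k) + 1 .. Max (dyadic_indices a b k).
             f (dyadic_point k n) * (dyadic_mean g k n - dyadic_mean g k (n - 1)))"

definition has_dyadic_integral ::
  "(real \<Rightarrow> real) \<Rightarrow> (real \<Rightarrow> real) \<Rightarrow> real \<Rightarrow> real \<Rightarrow> real \<Rightarrow> bool" where
  "has_dyadic_integral f g a b I \<longleftrightarrow> dyadic_sum f g a b \<longlonglongrightarrow> I"

definition dyadic_integral_exists ::
  "(real \<Rightarrow> real) \<Rightarrow> (real \<Rightarrow> real) \<Rightarrow> real \<Rightarrow> real \<Rightarrow> bool" where
  "dyadic_integral_exists f g a b \<longleftrightarrow> (\<exists>I. has_dyadic_integral f g a b I)"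

text \<open>The area between the step curves with heights \<^term>\<open>dyadic_mean g k\<close> and
  \<^term>\<open>dyadic_mean g (k + 1)\<close>: on a dyadic interval of level \<^term>\<open>k\<close> the coarse height is the
  average of the two fine ones, so both halves deviate from it by half their difference.\<close>

definition dyadic_area :: "(real \<Rightarrow> real) \<Rightarrow> nat \<Rightarrow> real" where
  "dyadic_area g k =
     (\<Sum>n < 2 ^ k. \<bar>dyadic_mean g (k + 1) (2 * n + 1) - dyadic_mean g (k + 1) (2 * n)\<bar>)
       / 2 ^ (k + 1)"

end

theory Submission
  imports Defs
begin

text \<open>
  Write $h_{k,n}$ for the dyadic means of $g$ and $d_{k,m} = h_{k+1,2m+1} - h_{k+1,2m}$ for its
  Haar details, so that $2^{k+1}|B_k(g)| = \sum_m |d_{k,m}|$. The approximating sum of level $k+1$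
  pairs values of $f$ with the jumps of the step function $h_{k+1}$. The jumps at odd points are
  details; since the two fine means deviate from the coarse one by half a detail, each jump at an
  even point is a jump of $h_k$ minus half of the two neighbouring details. Regrouping by details,
  passing from level $k$ to level $k+1$ adds
  \[ \sum_m d_{k,m} \Bigl(f(c_{k,m}) - \frac{f(t_{k,m}) + f(t_{k,m+1})}{2}\Bigr), \]
  where $c_{k,m}$ is the midpoint of $[t_{k,m}, t_{k,m+1}]$, up to a bounded number of terms at
  the two ends of $[a,b]$ (lemma \<open>jump_sum_refine\<close>).

  If the series converges, then so does the integral: a Hoelder function deviates at a midpoint
  from the average of the end values by $O(2^{-k\beta})$, which bounds the displayed sum by a
  multiple of the $k$-th term of the series, and the end terms are $O(2^{-k\alpha})$ because $g$ is
  Hoelder. So the increments of the approximating sums are absolutely summable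
  (\<open>dyadic_integral_exists_if_summable\<close>).

  Conversely, a single integrand on $[0,1]$ tests the series. The midpoint deviations of $f$ are
  its coefficients in the Faber--Schauder basis of tent functions, and prescribing coefficients of
  size at most $2^{-(k+1)\beta}$ always gives a Hoelder function of exponent $\beta < 1$
  (\<open>tent_series_holder\<close>). With the coefficient $2^{-(k+1)\beta}$ times the sign of $d_{k,m}$ there
  is no cancellation, and since this $f$ vanishes at $0$ and $1$ there are no end terms: the
  approximating sums are exactly the partial sums of the series
  (\<open>summable_if_dyadic_integral_exists\<close>).
\<close>

section \<open>Hoelder classes and dyadic points\<close>

lemma holder_class_iff:
  "f \<in> holder_class \<beta> \<longleftrightarrow>
     (\<exists>A\<ge>0. \<forall>s\<in>{0..1}. \<forall>t\<in>{0..1}. \<bar>f s - f t\<bar> \<le> A * \<bar>s - t\<bar> powr \<beta>)"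
proof
  assume "f \<in> holder_class \<beta>"
  then have "holder_seminorm \<beta> f \<noteq> \<infinity>"
    by (simp add: holder_class_def)
  then obtain B where B: "holder_seminorm \<beta> f \<le> ereal B"
    by (cases "holder_seminorm \<beta> f") auto
  have "\<bar>f s - f t\<bar> \<le> max B 0 * \<bar>s - t\<bar> powr \<beta>" if "s \<in> {0..1}" "t \<in> {0..1}" for s t
  proof (cases "s = t")
    case False
    have "ereal (\<bar>f s - f t\<bar> / \<bar>s - t\<bar> powr \<beta>) \<le> holder_seminorm \<beta> f"
      unfolding holder_seminorm_def by (rule SUP_upper2[of "(s, t)"]) (use that False in auto)
    with B have "\<bar>f s - f t\<bar> / \<bar>s - t\<bar> powr \<beta> \<le> B"
      using ereal_less_eq(3) order_trans by blast
    then have "\<bar>f s - f t\<bar> / \<bar>s - t\<bar> powr \<beta> \<le> max B 0"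
      by simp
    with False show ?thesis
      by (simp add: pos_divide_le_eq)
  qed simp
  then show "\<exists>A\<ge>0. \<forall>s\<in>{0..1}. \<forall>t\<in>{0..1}. \<bar>f s - f t\<bar> \<le> A * \<bar>s - t\<bar> powr \<beta>"
    by (intro exI[of _ "max B 0"]) auto
next
  assume "\<exists>A\<ge>0. \<forall>s\<in>{0..1}. \<forall>t\<in>{0..1}. \<bar>f s - f t\<bar> \<le> A * \<bar>s - t\<bar> powr \<beta>"
  then obtain A where A: "\<And>s t. s \<in> {0..1} \<Longrightarrow> t \<in> {0..1} \<Longrightarrow> \<bar>f s - f t\<bar> \<le> A * \<bar>s - t\<bar> powr \<beta>"
    by blast
  have "holder_seminorm \<beta> f \<le> ereal A"
    unfolding holder_seminorm_def
    by (rule SUP_least) (use A in \<open>auto simp: pos_divide_le_eq\<close>)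
  also have "\<dots> < \<infinity>" by simp
  finally show "f \<in> holder_class \<beta>"
    by (simp add: holder_class_def)
qed

lemma dyadic_point_mem_unit:
  assumes "n \<le> 2 ^ k"
  shows "dyadic_point k n \<in> {0..1}"
proof -
  have "real n \<le> real (2 ^ k)"
    using assms by (rule of_nat_mono)
  then show ?thesis
    by (simp add: dyadic_point_def)
qed

lemma dyadic_point_double: "dyadic_point (Suc k) (2 * n) = dyadic_point k n"
  by (simp add: dyadic_point_def)

lemma dyadic_length_powr: "(1 / 2 ^ k :: real) powr \<gamma> = (2 powr (-\<gamma>)) ^ k"
proof -
  have "(1 / 2 ^ k :: real) = 2 powr (- real k)"
    by (simp add: powr_minus powr_realpow divide_inverse)
  then show ?thesis
    by (simp add: powr_powr powr_power mult.commute)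
qed

section \<open>Dyadic means of a Hoelder function\<close>

lemma holder_imp_continuous_on:
  assumes "0 < \<alpha>" and g: "g \<in> holder_class \<alpha>"
  shows "continuous_on {0..1} g"
proof -
  obtain L where "L \<ge> 0"
    and L: "\<And>s t. s \<in> {0..1} \<Longrightarrow> t \<in> {0..1} \<Longrightarrow> \<bar>g s - g t\<bar> \<le> L * \<bar>s - t\<bar> powr \<alpha>"
    using g unfolding holder_class_iff by blast
  show ?thesis
    unfolding continuous_on_iff
  proof (intro ballI allI impI)
    fix x \<epsilon> :: real assume x: "x \<in> {0..1}" and "0 < \<epsilon>"
    define \<delta> where "\<delta> = (\<epsilon> / (L + 1)) powr (1 / \<alpha>)"
    have pos: "\<epsilon> / (L + 1) > 0"
      using \<open>L \<ge> 0\<close> \<open>0 < \<epsilon>\<close> by simp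
    have "dist (g y) (g x) < \<epsilon>" if y: "y \<in> {0..1}" and "dist y x < \<delta>" for y
    proof -
      have "\<bar>y - x\<bar> powr \<alpha> < \<delta> powr \<alpha>"
        using that \<open>0 < \<alpha>\<close> by (intro powr_less_mono2) (auto simp: dist_real_def)
      also have "\<delta> powr \<alpha> = \<epsilon> / (L + 1)"
        using pos \<open>0 < \<alpha>\<close> unfolding \<delta>_def powr_powr by (simp add: abs_of_pos del: abs_divide)
      finally have "(L + 1) * \<bar>y - x\<bar> powr \<alpha> < \<epsilon>"
        using \<open>L \<ge> 0\<close> by (simp add: field_simps)
      moreover have "\<bar>g y - g x\<bar> \<le> (L + 1) * \<bar>y - x\<bar> powr \<alpha>"
        using L[OF y x] powr_ge_zero[of "\<bar>y - x\<bar>" \<alpha>] unfolding distrib_right by linarith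
      ultimately show ?thesis
        by (simp add: dist_real_def)
    qed
    then show "\<exists>\<delta>>0. \<forall>y\<in>{0..1}. dist y x < \<delta> \<longrightarrow> dist (g y) (g x) < \<epsilon>"
      using pos by (intro exI[of _ \<delta>]) (auto simp: \<delta>_def)
  qed
qed

text \<open>Splitting the integral at the midpoint gives the one relation between consecutive levels
  on which the whole argument rests.\<close>

lemma dyadic_mean_halves:
  assumes g: "continuous_on {0..1} g" and n: "n < 2 ^ k"
  shows "dyadic_mean g k n =
    (dyadic_mean g (Suc k) (2 * n) + dyadic_mean g (Suc k) (Suc (2 * n))) / 2"
proof -
  let ?a = "dyadic_point k n" and ?b = "dyadic_point k (n + 1)"
  let ?c = "dyadic_point (Suc k) (Suc (2 * n))"
  have "?a \<in> {0..1}" "?b \<in> {0..1}"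
    using n by (auto intro!: dyadic_point_mem_unit simp del: atLeastAtMost_iff)
  then have "continuous_on {?a..?b} g"
    using g by (auto elim: continuous_on_subset)
  then have "g integrable_on {?a..?b}"
    by (rule integrable_continuous_real)
  then have "integral {?a..?c} g + integral {?c..?b} g = integral {?a..?b} g"
    by (intro Henstock_Kurzweil_Integration.integral_combine) (auto simp: dyadic_point_def field_simps)
  moreover have "dyadic_point (Suc k) (2 * n) = ?a" "dyadic_point (Suc k) (Suc (2 * n) + 1) = ?b"
    using dyadic_point_double[of k n] dyadic_point_double[of k "n + 1"] by simp_all
  ultimately show ?thesis
    by (simp add: dyadic_mean_def add_divide_distrib flip: distrib_left)
qed

lemma dyadic_mean_near_value:
  assumes g: "continuous_on {0..1} g" and n: "n < 2 ^ k"
    and L: "\<And>s t. s \<in> {0..1} \<Longrightarrow> t \<in> {0..1} \<Longrightarrow> \<bar>g s - g t\<bar> \<le> L * \<bar>s - t\<bar> powr \<alpha>"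
    and "0 < \<alpha>" "0 \<le> L"
    and x: "x \<in> {dyadic_point k n .. dyadic_point k (n + 1)}"
  shows "\<bar>dyadic_mean g k n - g x\<bar> \<le> L * (2 powr (-\<alpha>)) ^ k"
proof -
  let ?a = "dyadic_point k n" and ?b = "dyadic_point k (n + 1)"
  have ab: "?a \<in> {0..1}" "?b \<in> {0..1}"
    using n by (auto intro!: dyadic_point_mem_unit simp del: atLeastAtMost_iff)
  have len: "?b - ?a = 1 / 2 ^ k"
    by (simp add: dyadic_point_def field_simps)
  have cont: "continuous_on {?a..?b} g"
    using g ab by (auto elim: continuous_on_subset)
  have le: "?a \<le> ?b"
    by (simp add: dyadic_point_def field_simps)
  have "\<bar>integral {?a..?b} (\<lambda>t. g t - g x)\<bar> \<le> (L * (2 powr (-\<alpha>)) ^ k) * (?b - ?a)"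
  proof -
    have "norm (g t - g x) \<le> L * (2 powr (-\<alpha>)) ^ k" if t: "t \<in> {?a..?b}" for t
    proof -
      have "\<bar>g t - g x\<bar> \<le> L * \<bar>t - x\<bar> powr \<alpha>"
        using t x ab by (intro L) auto
      also have "\<bar>t - x\<bar> powr \<alpha> \<le> (1 / 2 ^ k) powr \<alpha>"
        using t x len \<open>0 < \<alpha>\<close> by (intro powr_mono2) auto
      finally show ?thesis
        using \<open>0 \<le> L\<close> by (simp add: dyadic_length_powr mult_left_mono)
    qed
    then have "norm (integral {?a..?b} (\<lambda>t. g t - g x)) \<le> (L * (2 powr (-\<alpha>)) ^ k) * (?b - ?a)"
      by (intro integral_bound[OF le] continuous_intros cont)
    then show ?thesis
      by simp
  qed
  moreover have "integral {?a..?b} (\<lambda>t. g t - g x) = integral {?a..?b} g - integral {?a..?b} (\<lambda>t. g x)"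
    by (intro Henstock_Kurzweil_Integration.integral_diff integrable_continuous_real cont
        continuous_on_const)
  moreover have "integral {?a..?b} (\<lambda>t. g x) = g x / 2 ^ k"
    using len le by simp
  ultimately have "\<bar>integral {?a..?b} g - g x / 2 ^ k\<bar> * 2 ^ k \<le> L * (2 powr (-\<alpha>)) ^ k"
    by (simp only: len) (simp add: field_simps)
  then have "\<bar>(integral {?a..?b} g - g x / 2 ^ k) * 2 ^ k\<bar> \<le> L * (2 powr (-\<alpha>)) ^ k"
    by (simp add: abs_mult)
  then show ?thesis
    by (simp add: dyadic_mean_def algebra_simps)
qed

text \<open>This makes every boundary term in the comparison of two levels decay geometrically.\<close>

lemma dyadic_mean_increment_bound:
  assumes "0 < \<alpha>" and g: "g \<in> holder_class \<alpha>"
  obtains L where "0 \<le> L"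
    "\<And>k n. 0 < n \<Longrightarrow> n < 2 ^ k \<Longrightarrow>
       \<bar>dyadic_mean g k n - dyadic_mean g k (n - 1)\<bar> \<le> L * (2 powr (-\<alpha>)) ^ k"
proof -
  obtain L where "L \<ge> 0"
    and L: "\<And>s t. s \<in> {0..1} \<Longrightarrow> t \<in> {0..1} \<Longrightarrow> \<bar>g s - g t\<bar> \<le> L * \<bar>s - t\<bar> powr \<alpha>"
    using g unfolding holder_class_iff by blast
  note near = dyadic_mean_near_value[OF holder_imp_continuous_on[OF assms] _ L \<open>0 < \<alpha>\<close> \<open>0 \<le> L\<close>]
  have "\<bar>dyadic_mean g k n - dyadic_mean g k (n - 1)\<bar> \<le> (2 * L) * (2 powr (-\<alpha>)) ^ k"
    if "0 < n" "n < 2 ^ k" for k n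
  proof -
    \<comment> \<open>Both means are compared with the value at the common end point.\<close>
    have "\<bar>dyadic_mean g k n - g (dyadic_point k n)\<bar> \<le> L * (2 powr (-\<alpha>)) ^ k"
      using that by (intro near) (auto simp: dyadic_point_def field_simps)
    moreover have "\<bar>dyadic_mean g k (n - 1) - g (dyadic_point k n)\<bar> \<le> L * (2 powr (-\<alpha>)) ^ k"
      using that by (intro near) (auto simp: dyadic_point_def field_simps)
    ultimately show ?thesis by linarith
  qed
  with \<open>L \<ge> 0\<close> show ?thesis
    by (intro that[of "2 * L"]) auto
qed

section \<open>Refining the approximating sums by one dyadic level\<close>

text \<open>Up to normalization, the Haar coefficient of $g$ on the $m$-th interval of level $k$.\<close>

definition dyadic_detail :: "(real \<Rightarrow> real) \<Rightarrow> nat \<Rightarrow> nat \<Rightarrow> real" where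
  "dyadic_detail g k m = dyadic_mean g (Suc k) (Suc (2 * m)) - dyadic_mean g (Suc k) (2 * m)"

text \<open>The Faber--Schauder coefficient of $f$ on the $m$-th interval of level $k$.\<close>

definition midpoint_deviation :: "(real \<Rightarrow> real) \<Rightarrow> nat \<Rightarrow> nat \<Rightarrow> real" where
  "midpoint_deviation f k m =
     f (dyadic_point (Suc k) (Suc (2 * m))) - (f (dyadic_point k m) + f (dyadic_point k (Suc m))) / 2"

text \<open>The approximating sums with free index bounds, so that the same sum can be taken over the
  level-$k$ points bracketing $[a,b]$ most tightly and over those inherited from level $k-1$. The
  range is open because a jump at $n$ involves the intervals on both sides of $t_{k,n}$.\<close>

definition jump_sum :: "(real \<Rightarrow> real) \<Rightarrow> (real \<Rightarrow> real) \<Rightarrow> nat \<Rightarrow> nat \<Rightarrow> nat \<Rightarrow> real" where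
  "jump_sum f g k l r =
     (\<Sum>n\<in>{l<..<r}. f (dyadic_point k n) * (dyadic_mean g k n - dyadic_mean g k (n - 1)))"

text \<open>The jumps are regrouped by the intervals of level $k$. Each interior point of level $k$ carries two half
  details, one from either side, and these supply the average of the end values in the midpoint
  deviations. The end points $p$ and $q$ carry no jump, so the half details that the deviations
  of the outermost intervals assume there have to be given back. The induction adds one interval
  of level $k$ on the right.\<close>

lemma jump_sum_refine:
  assumes g: "continuous_on {0..1} g" and "p < q" "q \<le> 2 ^ k"
  shows "jump_sum f g (Suc k) (2 * p) (2 * q) =
    jump_sum f g k p q + (\<Sum>m\<in>{p..<q}. dyadic_detail g k m * midpoint_deviation f k m)
    + (f (dyadic_point k p) * dyadic_detail g k p
       + f (dyadic_point k q) * dyadic_detail g k (q - 1)) / 2"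
  using \<open>p < q\<close>[THEN Suc_leI] \<open>q \<le> 2 ^ k\<close>
proof (induction q rule: dec_induct)
  case base
  have "{2 * p<..<2 * Suc p} = {Suc (2 * p)}" "{p<..<Suc p} = {}"
    by auto
  then show ?case
    by (simp add: jump_sum_def midpoint_deviation_def dyadic_detail_def field_simps)
next
  case (step q)
  then have q: "p < q" "0 < q" "q < 2 ^ k" by auto
  let ?h = "dyadic_mean g (Suc k)"
  have "{2 * p<..<2 * Suc q} = insert (Suc (2 * q)) (insert (2 * q) {2 * p<..<2 * q})"
    "{p<..<Suc q} = insert q {p<..<q}" "{p..<Suc q} = insert q {p..<q}"
    using q by auto
  then have S1: "jump_sum f g (Suc k) (2 * p) (2 * Suc q) = jump_sum f g (Suc k) (2 * p) (2 * q)
      + f (dyadic_point k q) * (?h (2 * q) - ?h (2 * q - 1))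
      + f (dyadic_point (Suc k) (Suc (2 * q))) * dyadic_detail g k q"
    and S2: "jump_sum f g k p (Suc q) = jump_sum f g k p q
      + f (dyadic_point k q) * (dyadic_mean g k q - dyadic_mean g k (q - 1))"
    and S3: "(\<Sum>m\<in>{p..<Suc q}. dyadic_detail g k m * midpoint_deviation f k m) =
      (\<Sum>m\<in>{p..<q}. dyadic_detail g k m * midpoint_deviation f k m)
      + dyadic_detail g k q * midpoint_deviation f k q"
    by (simp_all add: jump_sum_def dyadic_point_double dyadic_detail_def)
  have odd: "Suc (2 * (q - 1)) = 2 * q - 1"
    using q by simp
  have mean: "dyadic_mean g k q = ?h (2 * q) + dyadic_detail g k q / 2"
    "dyadic_mean g k (q - 1) = ?h (2 * q - 1) - dyadic_detail g k (q - 1) / 2"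
    using dyadic_mean_halves[OF g, of q k] dyadic_mean_halves[OF g, of "q - 1" k, unfolded odd] q
    unfolding dyadic_detail_def odd by (simp_all del: One_nat_def add: field_simps)
  have IH: "jump_sum f g (Suc k) (2 * p) (2 * q) =
    jump_sum f g k p q + (\<Sum>m\<in>{p..<q}. dyadic_detail g k m * midpoint_deviation f k m)
    + (f (dyadic_point k p) * dyadic_detail g k p
       + f (dyadic_point k q) * dyadic_detail g k (q - 1)) / 2"
    using step by simp
  show ?case
    unfolding S1 S2 S3 IH mean by (simp add: midpoint_deviation_def field_simps)
qed

text \<open>An index of level $k+1$ is admissible iff its parent interval of level $k$ lies in $[a,b]$;
  the parents are those from $\lceil 2^k a\rceil$ up to, but excluding, $\lfloor 2^k b\rfloor$. If
  there is none, the range of the jump sum is empty as well, so no case distinction is left.\<close>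

lemma dyadic_sum_Suc:
  assumes "0 \<le> a" "b \<le> 1"
  shows "dyadic_sum f g a b (Suc k) =
    jump_sum f g (Suc k) (2 * nat \<lceil>a * 2 ^ k\<rceil>) (2 * nat \<lfloor>b * 2 ^ k\<rfloor>)"
proof -
  define p q where "p = nat \<lceil>a * 2 ^ k\<rceil>" and "q = nat \<lfloor>b * 2 ^ k\<rfloor>"
  have p: "a \<le> dyadic_point k m \<longleftrightarrow> p \<le> m" for m
    unfolding p_def dyadic_point_def nat_le_iff ceiling_le_iff by (simp add: field_simps)
  have q: "dyadic_point k (Suc m) \<le> b \<longleftrightarrow> Suc m \<le> q" for m
  proof -
    have "Suc m \<le> q \<longleftrightarrow> int (Suc m) \<le> \<lfloor>b * 2 ^ k\<rfloor>"
      unfolding q_def by linarith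
    then show ?thesis
      unfolding le_floor_iff dyadic_point_def by (simp add: field_simps)
  qed
  have "\<lfloor>b * 2 ^ k\<rfloor> \<le> \<lfloor>real (2 ^ k)\<rfloor>"
    using \<open>b \<le> 1\<close> by (intro floor_mono) simp
  then have q2: "q \<le> 2 ^ k"
    unfolding q_def floor_of_nat by simp
  have "dyadic_point k m \<le> dyadic_point k (Suc m)" for m
    by (simp add: dyadic_point_def field_simps)
  then have "dyadic_indices a b (Suc k) = {n. n \<le> 2 ^ Suc k \<and> p \<le> n div 2 \<and> Suc (n div 2) \<le> q}"
    by (simp add: dyadic_indices_def p q)
  also have "\<dots> = {2 * p..<2 * q}"
    using q2 by auto
  finally have I: "dyadic_indices a b (Suc k) = {2 * p..<2 * q}" .
  show ?thesis
  proof (cases "p < q")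
    case True
    have "Min {2 * p..<2 * q} = 2 * p" "Max {2 * p..<2 * q} = 2 * q - 1"
      using True by (auto intro!: Min_eqI Max_eqI)
    moreover have "{2 * p + 1..2 * q - 1} = {2 * p<..<2 * q}"
      using True by auto
    ultimately show ?thesis
      using True by (simp add: dyadic_sum_def I jump_sum_def flip: p_def q_def)
  next
    case False
    then show ?thesis
      by (simp add: dyadic_sum_def I jump_sum_def flip: p_def q_def)
  qed
qed

lemma dyadic_area_eq: "2 ^ Suc k * dyadic_area g k = (\<Sum>m<2 ^ k. \<bar>dyadic_detail g k m\<bar>)"
  by (simp add: dyadic_area_def dyadic_detail_def)

lemma weight_eq: "2 powr (real (k + 1) * (1 - \<beta>)) = (2 powr (-\<beta>)) ^ Suc k * 2 ^ Suc k"
proof -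
  have "2 powr (-\<beta>) * 2 = 2 powr (1 - \<beta>)"
    by (simp add: powr_diff powr_minus divide_inverse)
  then have "(2 powr (-\<beta>)) ^ Suc k * 2 ^ Suc k = (2 powr (1 - \<beta>)) ^ Suc k"
    by (metis power_mult_distrib)
  also have "\<dots> = 2 powr (real (k + 1) * (1 - \<beta>))"
    by (subst powr_power) (simp_all add: mult.commute)
  finally show ?thesis ..
qed

section \<open>Summability implies existence of the integral\<close>

lemma holder_class_bounded:
  assumes "0 < \<beta>" "f \<in> holder_class \<beta>"
  obtains M where "0 \<le> M" "\<And>x. x \<in> {0..1} \<Longrightarrow> \<bar>f x\<bar> \<le> M"
proof -
  obtain A where "A \<ge> 0"
    and A: "\<And>s t. s \<in> {0..1} \<Longrightarrow> t \<in> {0..1} \<Longrightarrow> \<bar>f s - f t\<bar> \<le> A * \<bar>s - t\<bar> powr \<beta>"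
    using assms unfolding holder_class_iff by blast
  have "\<bar>f x\<bar> \<le> \<bar>f 0\<bar> + A" if x: "x \<in> {0..1}" for x
  proof -
    have "\<bar>f x - f 0\<bar> \<le> A * \<bar>x - 0\<bar> powr \<beta>"
      using x by (intro A) auto
    also have "\<dots> \<le> A * 1"
      using x assms \<open>A \<ge> 0\<close> by (intro mult_left_mono powr_le1) auto
    finally show ?thesis by linarith
  qed
  then show ?thesis
    using \<open>A \<ge> 0\<close> by (intro that[of "\<bar>f 0\<bar> + A"]) auto
qed

lemma midpoint_deviation_bound:
  assumes A: "\<And>s t. s \<in> {0..1} \<Longrightarrow> t \<in> {0..1} \<Longrightarrow> \<bar>f s - f t\<bar> \<le> A * \<bar>s - t\<bar> powr \<beta>"
    and "m < 2 ^ k"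
  shows "\<bar>midpoint_deviation f k m\<bar> \<le> A * (2 powr (-\<beta>)) ^ Suc k"
proof -
  let ?x = "dyadic_point k m" and ?y = "dyadic_point k (Suc m)"
  let ?c = "dyadic_point (Suc k) (Suc (2 * m))"
  have mem: "?x \<in> {0..1}" "?y \<in> {0..1}" "?c \<in> {0..1}"
    using \<open>m < 2 ^ k\<close> by (intro dyadic_point_mem_unit; simp)+
  have "\<bar>?c - ?x\<bar> = 1 / 2 ^ Suc k" "\<bar>?c - ?y\<bar> = 1 / 2 ^ Suc k"
    by (simp_all add: dyadic_point_def field_simps)
  then have "\<bar>f ?c - f ?x\<bar> \<le> A * (2 powr (-\<beta>)) ^ Suc k"
    "\<bar>f ?c - f ?y\<bar> \<le> A * (2 powr (-\<beta>)) ^ Suc k"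
    using A[OF mem(3,1)] A[OF mem(3,2)] by (simp_all only: dyadic_length_powr)
  then show ?thesis
    unfolding midpoint_deviation_def by (simp only: abs_le_iff) (simp add: field_simps)
qed

text \<open>The admissible ranges at two consecutive levels differ by at most one point at either end,
  hence by at most two jumps.\<close>

lemma jump_sum_trim:
  assumes "p \<le> p'" "p' \<le> Suc p" "q' \<le> q" "q \<le> Suc q'" "q \<le> 2 ^ k"
    and M: "0 \<le> M" "\<And>x. x \<in> {0..1} \<Longrightarrow> \<bar>f x\<bar> \<le> M"
    and D: "0 \<le> D"
      "\<And>n. 0 < n \<Longrightarrow> n < 2 ^ k \<Longrightarrow> \<bar>dyadic_mean g k n - dyadic_mean g k (n - 1)\<bar> \<le> D"
  shows "\<bar>jump_sum f g k p q - jump_sum f g k p' q'\<bar> \<le> 2 * (M * D)"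
proof -
  let ?t = "\<lambda>n. f (dyadic_point k n) * (dyadic_mean g k n - dyadic_mean g k (n - 1))"
  let ?R = "{p<..<q} - {p'<..<q'}"
  have "{p'<..<q'} \<subseteq> {p<..<q}" using assms by auto
  then have "jump_sum f g k p q - jump_sum f g k p' q' = sum ?t ?R"
    by (simp add: jump_sum_def sum_diff)
  also have "\<bar>sum ?t ?R\<bar> \<le> (\<Sum>n\<in>?R. \<bar>?t n\<bar>)"
    by (rule sum_abs)
  also have "\<dots> \<le> real (card ?R) * (M * D)"
  proof (rule sum_bounded_above)
    fix n assume "n \<in> ?R"
    then have "0 < n" "n < 2 ^ k" using assms by auto
    then show "\<bar>?t n\<bar> \<le> M * D"
      unfolding abs_mult using M D by (intro mult_mono dyadic_point_mem_unit M D) auto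
  qed
  also have "\<dots> \<le> 2 * (M * D)"
  proof (rule mult_right_mono)
    have "?R \<subseteq> {Suc p, q - 1}" using assms by auto
    then have "card ?R \<le> card {Suc p, q - 1}" by (intro card_mono) auto
    also have "\<dots> \<le> 2" by (simp add: card_insert_if)
    finally show "real (card ?R) \<le> 2" by simp
  qed (use M D in simp)
  finally show ?thesis .
qed

text \<open>The quantitative form of the refinement identity for a Hoelder integrand: the weight
  $2^{(k+1)(1-\beta)}$ is the product of $2^{-(k+1)\beta}$ from the midpoint deviations and of
  $2^{k+1}$, which turns the area into the sum of the absolute details.\<close>

lemma jump_sum_refine_bound:
  assumes g: "continuous_on {0..1} g" and "q \<le> 2 ^ k"
    and A: "0 \<le> A" "\<And>s t. s \<in> {0..1} \<Longrightarrow> t \<in> {0..1} \<Longrightarrow> \<bar>f s - f t\<bar> \<le> A * \<bar>s - t\<bar> powr \<beta>"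
    and M: "0 \<le> M" "\<And>x. x \<in> {0..1} \<Longrightarrow> \<bar>f x\<bar> \<le> M"
    and D: "0 \<le> D" "\<And>m. m < 2 ^ k \<Longrightarrow> \<bar>dyadic_detail g k m\<bar> \<le> D"
  shows "\<bar>jump_sum f g (Suc k) (2 * p) (2 * q) - jump_sum f g k p q\<bar>
    \<le> A * (2 powr (real (k + 1) * (1 - \<beta>)) * dyadic_area g k) + M * D"
proof -
  let ?r = "(2 powr (-\<beta>)) ^ Suc k"
  let ?\<Sigma> = "\<Sum>m<2 ^ k. \<bar>dyadic_detail g k m\<bar>"
  have area: "2 powr (real (k + 1) * (1 - \<beta>)) * dyadic_area g k = ?r * ?\<Sigma>"
    unfolding weight_eq mult.assoc dyadic_area_eq ..
  show ?thesis
  proof (cases "p < q")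
    case True
    have fd: "\<bar>f (dyadic_point k n) * dyadic_detail g k m\<bar> \<le> M * D" if "n \<le> 2 ^ k" "m < 2 ^ k" for n m
      unfolding abs_mult using that M D by (intro mult_mono dyadic_point_mem_unit M D) auto
    have "\<bar>\<Sum>m\<in>{p..<q}. dyadic_detail g k m * midpoint_deviation f k m\<bar>
        \<le> (\<Sum>m\<in>{p..<q}. \<bar>dyadic_detail g k m\<bar> * (A * ?r))"
      using \<open>q \<le> 2 ^ k\<close>
      by (intro order_trans[OF sum_abs] sum_mono)
        (auto simp only: abs_mult atLeastLessThan_iff intro!: mult_left_mono midpoint_deviation_bound A)
    also have "\<dots> \<le> (\<Sum>m<2 ^ k. \<bar>dyadic_detail g k m\<bar> * (A * ?r))"
      using \<open>q \<le> 2 ^ k\<close> A by (intro sum_mono2) auto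
    also have "\<dots> = A * (?r * ?\<Sigma>)"
      by (simp add: sum_distrib_left sum_distrib_right mult_ac)
    finally have "\<bar>\<Sum>m\<in>{p..<q}. dyadic_detail g k m * midpoint_deviation f k m\<bar> \<le> A * (?r * ?\<Sigma>)" .
    moreover have "\<bar>f (dyadic_point k p) * dyadic_detail g k p\<bar> \<le> M * D"
      "\<bar>f (dyadic_point k q) * dyadic_detail g k (q - 1)\<bar> \<le> M * D"
      using True \<open>q \<le> 2 ^ k\<close> by (intro fd; simp)+
    moreover have "\<bar>s\<bar> \<le> X \<Longrightarrow> \<bar>u\<bar> \<le> Y \<Longrightarrow> \<bar>v\<bar> \<le> Y \<Longrightarrow> \<bar>J + s + (u + v) / 2 - J\<bar> \<le> X + Y"
      for s u v J X Y :: real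
      unfolding abs_le_iff by (elim conjE, intro conjI; simp add: field_simps)
    ultimately show ?thesis
      unfolding jump_sum_refine[OF g True \<open>q \<le> 2 ^ k\<close>] area by blast
  next
    case False
    moreover have "0 \<le> A * (?r * ?\<Sigma>) + M * D"
      by (intro add_nonneg_nonneg mult_nonneg_nonneg sum_nonneg A M D) auto
    ultimately show ?thesis
      unfolding area by (simp add: jump_sum_def)
  qed
qed

lemma nat_ceiling_double:
  fixes x :: real
  shows "nat \<lceil>2 * x\<rceil> \<le> 2 * nat \<lceil>x\<rceil>" "2 * nat \<lceil>x\<rceil> \<le> Suc (nat \<lceil>2 * x\<rceil>)"
proof -
  define c d where "c = \<lceil>x\<rceil>" and "d = \<lceil>2 * x\<rceil>"
  have "x \<le> real_of_int c" "real_of_int c < x + 1" "2 * x \<le> real_of_int d" "real_of_int d < 2 * x + 1"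
    unfolding c_def d_def by linarith+
  then have "d \<le> 2 * c" "2 * c \<le> d + 1"
    by linarith+
  then show "nat \<lceil>2 * x\<rceil> \<le> 2 * nat \<lceil>x\<rceil>" "2 * nat \<lceil>x\<rceil> \<le> Suc (nat \<lceil>2 * x\<rceil>)"
    unfolding c_def[symmetric] d_def[symmetric] by linarith+
qed

lemma nat_floor_double:
  fixes x :: real
  assumes "0 \<le> x"
  shows "2 * nat \<lfloor>x\<rfloor> \<le> nat \<lfloor>2 * x\<rfloor>" "nat \<lfloor>2 * x\<rfloor> \<le> Suc (2 * nat \<lfloor>x\<rfloor>)"
proof -
  define c d where "c = \<lfloor>x\<rfloor>" and "d = \<lfloor>2 * x\<rfloor>"
  have "0 \<le> c" "real_of_int c \<le> x" "x < real_of_int c + 1" "real_of_int d \<le> 2 * x" "2 * x < real_of_int d + 1"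
    using assms unfolding c_def d_def by (simp, linarith+)
  then have "0 \<le> c" "2 * c \<le> d" "d \<le> 2 * c + 1"
    by linarith+
  then show "2 * nat \<lfloor>x\<rfloor> \<le> nat \<lfloor>2 * x\<rfloor>" "nat \<lfloor>2 * x\<rfloor> \<le> Suc (2 * nat \<lfloor>x\<rfloor>)"
    unfolding c_def[symmetric] d_def[symmetric] by linarith+
qed

lemma summable_increments_imp_convergent:
  fixes X :: "nat \<Rightarrow> real"
  assumes "summable (\<lambda>k. X (Suc k) - X k)"
  shows "convergent X"
proof -
  have "convergent (\<lambda>n. X n - X 0)"
    using assms by (simp add: summable_iff_convergent sum_lessThan_telescope)
  then have "convergent (\<lambda>n. (X n - X 0) + X 0)"
    by (intro convergent_add convergent_const)
  then show ?thesis by simp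
qed

text \<open>The increments of the approximating sums are dominated by a convergent series: the given
  one for the refinement itself, and a geometric one for the boundary terms.\<close>

lemma dyadic_integral_exists_if_summable:
  assumes "0 < \<alpha>" "0 < \<beta>" and g: "g \<in> holder_class \<alpha>" and f: "f \<in> holder_class \<beta>"
    and ab: "0 \<le> a" "a < b" "b \<le> 1"
    and sm: "summable (\<lambda>k. 2 powr (real (k + 1) * (1 - \<beta>)) * dyadic_area g k)"
  shows "dyadic_integral_exists f g a b"
proof -
  obtain A where A: "A \<ge> 0"
    "\<And>s t. s \<in> {0..1} \<Longrightarrow> t \<in> {0..1} \<Longrightarrow> \<bar>f s - f t\<bar> \<le> A * \<bar>s - t\<bar> powr \<beta>"
    using f unfolding holder_class_iff by blast
  obtain M where M: "0 \<le> M" "\<And>x. x \<in> {0..1} \<Longrightarrow> \<bar>f x\<bar> \<le> M"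
    using holder_class_bounded[OF \<open>0 < \<beta>\<close> f] by blast
  obtain L where L: "0 \<le> L" "\<And>k n. 0 < n \<Longrightarrow> n < 2 ^ k \<Longrightarrow>
      \<bar>dyadic_mean g k n - dyadic_mean g k (n - 1)\<bar> \<le> L * (2 powr (-\<alpha>)) ^ k"
    using dyadic_mean_increment_bound[OF \<open>0 < \<alpha>\<close> g] by blast
  let ?\<sigma> = "2 powr (-\<alpha>) :: real"
  let ?w = "\<lambda>k. 2 powr (real (k + 1) * (1 - \<beta>)) * dyadic_area g k"
  let ?S = "dyadic_sum f g a b"
  have \<sigma>: "0 < ?\<sigma>" "?\<sigma> < 1"
    using \<open>0 < \<alpha>\<close> by (auto intro: powr_less_one)
  \<comment> \<open>Refine the sum over the tightest level-\<open>k\<close> bracket, then compare that bracket with the one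
    inherited from level \<open>i\<close>. Refining costs one boundary term, comparing costs two.\<close>
  have step: "\<bar>?S (Suc (Suc i)) - ?S (Suc i)\<bar> \<le> A * ?w (Suc i) + 3 * (M * L) * ?\<sigma> ^ Suc i" for i
  proof -
    define k where "k = Suc i"
    define p q where "p = nat \<lceil>a * 2 ^ k\<rceil>" and "q = nat \<lfloor>b * 2 ^ k\<rfloor>"
    define p' q' where "p' = 2 * nat \<lceil>a * 2 ^ i\<rceil>" and "q' = 2 * nat \<lfloor>b * 2 ^ i\<rfloor>"
    have pq: "p \<le> p'" "p' \<le> Suc p" "q' \<le> q" "q \<le> Suc q'"
      using nat_ceiling_double[of "a * 2 ^ i"] nat_floor_double[of "b * 2 ^ i"] ab
      by (simp_all add: p_def q_def p'_def q'_def k_def mult.left_commute)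
    have "\<lfloor>b * 2 ^ k\<rfloor> \<le> \<lfloor>real (2 ^ k)\<rfloor>"
      using ab by (intro floor_mono) simp
    then have q: "q \<le> 2 ^ k"
      unfolding q_def floor_of_nat by simp
    have "\<bar>dyadic_detail g k m\<bar> \<le> L * ?\<sigma> ^ k" if "m < 2 ^ k" for m
    proof -
      have "\<bar>dyadic_detail g k m\<bar> \<le> L * ?\<sigma> ^ Suc k"
        using L(2)[of "Suc (2 * m)" "Suc k"] that by (simp add: dyadic_detail_def)
      also have "\<dots> \<le> L * ?\<sigma> ^ k"
        using \<sigma> L by (intro mult_left_mono power_decreasing) auto
      finally show ?thesis .
    qed
    then have "\<bar>jump_sum f g (Suc k) (2 * p) (2 * q) - jump_sum f g k p q\<bar>
        \<le> A * ?w k + M * (L * ?\<sigma> ^ k)"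
      using L by (intro jump_sum_refine_bound holder_imp_continuous_on[OF \<open>0 < \<alpha>\<close> g] q A M) auto
    moreover have "\<bar>jump_sum f g k p q - jump_sum f g k p' q'\<bar> \<le> 2 * (M * (L * ?\<sigma> ^ k))"
      using L by (intro jump_sum_trim pq q M) auto
    moreover have "?S (Suc k) = jump_sum f g (Suc k) (2 * p) (2 * q)"
      "?S k = jump_sum f g k p' q'"
      using ab by (simp_all add: dyadic_sum_Suc k_def p_def q_def p'_def q'_def)
    ultimately show ?thesis
      unfolding k_def[symmetric] by (simp add: algebra_simps)
  qed
  have "summable (\<lambda>i. ?\<sigma> ^ Suc i)"
    using \<sigma> unfolding summable_Suc_iff by (intro summable_geometric) simp
  moreover have "summable (\<lambda>i. ?w (Suc i))"
    by (rule iffD2[OF summable_Suc_iff[of ?w] sm])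
  ultimately have "summable (\<lambda>i. A * ?w (Suc i) + 3 * (M * L) * ?\<sigma> ^ Suc i)"
    by (intro summable_add summable_mult)
  then have "summable (\<lambda>i. ?S (Suc (Suc i)) - ?S (Suc i))"
    by (rule summable_comparison_test'[where N = 0]) (use step in simp)
  then have "convergent (\<lambda>i. ?S (Suc i))"
    by (rule summable_increments_imp_convergent)
  then obtain I where "(\<lambda>i. ?S (Suc i)) \<longlonglongrightarrow> I"
    by (auto simp: convergent_def)
  then have "?S \<longlonglongrightarrow> I"
    by (rule LIMSEQ_imp_Suc)
  then show ?thesis
    by (auto simp: dyadic_integral_exists_def has_dyadic_integral_def)
qed

section \<open>An integrand that resonates with the details of the integrator\<close>

text \<open>A row of tents over the unit intervals $[n, n+1]$, with peak value $e_n$ at the midpoint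
  and zeros at the integers.\<close>

definition signed_tents :: "(nat \<Rightarrow> real) \<Rightarrow> real \<Rightarrow> real" where
  "signed_tents e x = e (nat \<lfloor>x\<rfloor>) * (1 - \<bar>2 * frac x - 1\<bar>)"

text \<open>The formula extends to the right end point, where this tent and the next one both vanish;
  closed intervals are what the dyadic points require.\<close>

lemma signed_tents_eq:
  assumes "real q \<le> x" "x \<le> real q + 1"
  shows "signed_tents e x = e q * (1 - \<bar>2 * (x - real q) - 1\<bar>)"
proof (cases "x < real q + 1")
  case True
  then have "\<lfloor>x\<rfloor> = int q"
    using assms by (simp add: floor_eq_iff)
  then show ?thesis
    by (simp add: signed_tents_def frac_def)
next
  case False
  then have "x = real (Suc q)" using assms by simp
  then show ?thesis
    unfolding signed_tents_def by (simp add: frac_def)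
qed

lemma signed_tents_of_nat [simp]: "signed_tents e (real n) = 0"
  by (simp add: signed_tents_eq[of n])

lemma signed_tents_bounded:
  assumes e: "\<And>n. \<bar>e n\<bar> \<le> 1"
  shows "\<bar>signed_tents e x\<bar> \<le> 1"
proof -
  have "0 \<le> frac x" "frac x < 1"
    by (simp_all add: frac_lt_1)
  then have "\<bar>1 - \<bar>2 * frac x - 1\<bar>\<bar> \<le> 1"
    by linarith
  then show ?thesis
    unfolding signed_tents_def abs_mult by (intro mult_le_one e) auto
qed

lemma signed_tents_lipschitz:
  assumes e: "\<And>n. \<bar>e n\<bar> \<le> 1" and "0 \<le> x" "0 \<le> y"
  shows "\<bar>signed_tents e x - signed_tents e y\<bar> \<le> 2 * \<bar>x - y\<bar>"
  using assms(2,3)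
proof (induction x y rule: linorder_wlog)
  case (le x y)
  have scale: "\<bar>e q * z\<bar> \<le> \<bar>z\<bar>" for q z
    unfolding abs_mult using mult_right_mono[OF e[of q], of "\<bar>z\<bar>"] by simp
  define q n where "q = nat \<lfloor>x\<rfloor>" and "n = nat \<lfloor>y\<rfloor>"
  have q: "real q \<le> x" "x \<le> real q + 1" and n: "real n \<le> y" "y \<le> real n + 1"
    using le unfolding q_def n_def by linarith+
  show ?case
  proof (cases "y \<le> real q + 1")
    case True
    have "signed_tents e x - signed_tents e y
        = e q * (\<bar>2 * (y - real q) - 1\<bar> - \<bar>2 * (x - real q) - 1\<bar>)"
      using q le True by (simp add: signed_tents_eq[of q] algebra_simps)
    also have "\<bar>\<dots>\<bar> \<le> \<bar>\<bar>2 * (y - real q) - 1\<bar> - \<bar>2 * (x - real q) - 1\<bar>\<bar>"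
      by (rule scale)
    also have "\<dots> \<le> \<bar>(2 * (y - real q) - 1) - (2 * (x - real q) - 1)\<bar>"
      by (rule abs_triangle_ineq3)
    also have "\<dots> = 2 * \<bar>x - y\<bar>"
      by (auto simp: abs_if)
    finally show ?thesis .
  next
    case False
    \<comment> \<open>An integer, where both tents vanish, lies between the two points.\<close>
    then have "q + 1 \<le> n"
      unfolding n_def by (intro le_nat_floor) simp
    then have "real q + 1 \<le> real n"
      by simp
    have "\<bar>signed_tents e x - signed_tents e y\<bar> \<le> \<bar>signed_tents e x\<bar> + \<bar>signed_tents e y\<bar>"
      by (rule abs_triangle_ineq4)
    also have "\<bar>signed_tents e x\<bar> \<le> 2 * (real q + 1 - x)"
      unfolding signed_tents_eq[OF q] by (rule order_trans[OF scale]) (use q in \<open>auto simp: abs_if\<close>)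
    also have "\<bar>signed_tents e y\<bar> \<le> 2 * (y - real n)"
      unfolding signed_tents_eq[OF n] by (rule order_trans[OF scale]) (use n in \<open>auto simp: abs_if\<close>)
    also have "2 * (real q + 1 - x) + 2 * (y - real n) \<le> 2 * \<bar>x - y\<bar>"
      using \<open>real q + 1 \<le> real n\<close> abs_ge_minus_self[of "x - y"] by (simp add: algebra_simps)
    finally show ?thesis by simp
  qed
next
  case (sym x y)
  then have "\<bar>signed_tents e y - signed_tents e x\<bar> \<le> 2 * \<bar>y - x\<bar>"
    by blast
  then show ?case
    by (simp only: abs_minus_commute[of "signed_tents e x"] abs_minus_commute[of x])
qed

text \<open>The kinks lie at the integers and half-integers only.\<close>

lemma signed_tents_affine:
  "\<exists>A B. \<forall>z. real u / 2 \<le> z \<and> z \<le> (real u + 1) / 2 \<longrightarrow> signed_tents e z = A * z + B"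
proof (cases "even u")
  case True
  then obtain q where u: "u = 2 * q" by blast
  have "signed_tents e z = (2 * e q) * z + (- 2 * e q * real q)"
    if "real u / 2 \<le> z" "z \<le> (real u + 1) / 2" for z
  proof -
    have "\<bar>2 * (z - real q) - 1\<bar> = 1 - 2 * (z - real q)" using that u by simp
    then show ?thesis
      using that u by (subst signed_tents_eq[of q]) (simp_all add: algebra_simps)
  qed
  then show ?thesis by blast
next
  case False
  then obtain q where u: "u = 2 * q + 1" by (blast elim: oddE)
  have "signed_tents e z = (- 2 * e q) * z + (2 * e q + 2 * e q * real q)"
    if "real u / 2 \<le> z" "z \<le> (real u + 1) / 2" for z
  proof -
    have "\<bar>2 * (z - real q) - 1\<bar> = 2 * (z - real q) - 1" using that u by (simp add: field_simps)
    then show ?thesis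
      using that u by (subst signed_tents_eq[of q]) (simp_all add: field_simps)
  qed
  then show ?thesis by blast
qed

lemma signed_tents_coarser_dyadic:
  assumes "i \<le> k"
  shows "signed_tents e (2 ^ k * dyadic_point i n) = 0"
proof -
  obtain d where "k = i + d"
    using assms by (auto simp: le_iff_add)
  then have "2 ^ k * dyadic_point i n = real (2 ^ d * n)"
    by (simp add: dyadic_point_def power_add)
  then show ?thesis
    by (simp only: signed_tents_of_nat)
qed

text \<open>Biorthogonality of the Faber--Schauder basis. Rows finer than level $j$ vanish at all three
  points, and coarser rows are affine on the interval.\<close>

lemma midpoint_deviation_signed_tents:
  "midpoint_deviation (\<lambda>t. signed_tents e (2 ^ k * t)) j m = (if k = j then e m else 0)"
proof -
  consider "Suc j \<le> k" | "j = k" | i where "j = Suc (k + i)"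
    by (metis less_iff_Suc_add linorder_neqE_nat Suc_leI)
  then show ?thesis
  proof cases
    case 1
    then show ?thesis
      by (simp add: midpoint_deviation_def signed_tents_coarser_dyadic)
  next
    case 2
    have mid: "2 ^ k * dyadic_point (Suc k) (Suc (2 * m)) = real m + 1 / 2"
      by (simp add: dyadic_point_def field_simps)
    have "signed_tents e (real m + 1 / 2) = e m"
      by (subst signed_tents_eq[of m]) simp_all
    then show ?thesis
      unfolding midpoint_deviation_def 2 mid
      by (simp add: signed_tents_coarser_dyadic)
  next
    case 3
    \<comment> \<open>After scaling, the interval lies inside the \<open>u\<close>-th half of a unit interval.\<close>
    define u where "u = m div 2 ^ i"
    have "u * 2 ^ i \<le> m" "Suc m \<le> (u + 1) * 2 ^ i"
      unfolding u_def distrib_right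
      using div_mult_mod_eq[of m "2 ^ i"] mod_less_divisor[of "2 ^ i" m, OF zero_less_power[OF zero_less_numeral]]
      by linarith+
    then have "real (u * 2 ^ i) \<le> real m" "real (Suc m) \<le> real ((u + 1) * 2 ^ i)"
      by (simp_all only: of_nat_le_iff)
    then have u: "real u * 2 ^ i \<le> real m" "real m + 1 \<le> (real u + 1) * 2 ^ i"
      by (simp_all add: algebra_simps)
    let ?x = "2 ^ k * dyadic_point j m" and ?y = "2 ^ k * dyadic_point j (Suc m)"
    let ?c = "2 ^ k * dyadic_point (Suc j) (Suc (2 * m))"
    have x: "?x = real m / 2 ^ i / 2" and y: "?y = (real m + 1) / 2 ^ i / 2"
      by (simp_all add: dyadic_point_def 3 power_add field_simps)
    have c: "?c = (?x + ?y) / 2"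
      by (simp add: dyadic_point_def field_simps)
    have scaled: "real u \<le> real m / 2 ^ i" "(real m + 1) / 2 ^ i \<le> real u + 1" "real m / 2 ^ i \<le> (real m + 1) / 2 ^ i"
      using u by (simp_all add: field_simps)
    have *: "real u / 2 \<le> ?x" "?y \<le> (real u + 1) / 2" "?x \<le> ?y"
      unfolding x y by (intro divide_right_mono scaled; simp)+
    obtain A B where AB: "\<And>z. real u / 2 \<le> z \<Longrightarrow> z \<le> (real u + 1) / 2 \<Longrightarrow> signed_tents e z = A * z + B"
      using signed_tents_affine[of u e] by blast
    have "signed_tents e ?x = A * ?x + B" "signed_tents e ?y = A * ?y + B"
      using * by (intro AB; linarith)+
    moreover have "signed_tents e ?c = A * ?c + B"
    proof -
      have "l \<le> (X + Y) / 2 \<and> (X + Y) / 2 \<le> r" if "l \<le> X" "Y \<le> r" "X \<le> Y" for l r X Y :: real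
        using that by (simp add: field_simps)
      from this[OF *] show ?thesis
        unfolding c by (intro AB) blast+
    qed
    ultimately show ?thesis
      unfolding midpoint_deviation_def using 3 c by (simp add: field_simps)
  qed
qed

text \<open>The function with prescribed Faber--Schauder coefficients. The exponent is $k+1$ because
  the tents of row $k$ have half-width $2^{-(k+1)}$.\<close>

definition tent_series :: "real \<Rightarrow> (nat \<Rightarrow> nat \<Rightarrow> real) \<Rightarrow> real \<Rightarrow> real" where
  "tent_series \<beta> e t = (\<Sum>k. (2 powr (-\<beta>)) ^ Suc k * signed_tents (e k) (2 ^ k * t))"

context
  fixes \<beta> :: real and e :: "nat \<Rightarrow> nat \<Rightarrow> real"
  assumes \<beta>: "0 < \<beta>" and e: "\<And>k n. \<bar>e k n\<bar> \<le> 1"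
begin

lemma tent_row_bounded: "\<bar>signed_tents (e k) x\<bar> \<le> 1"
  by (intro signed_tents_bounded e)

lemma tent_series_sums:
  "(\<lambda>k. (2 powr (-\<beta>)) ^ Suc k * signed_tents (e k) (2 ^ k * t)) sums tent_series \<beta> e t"
  unfolding tent_series_def
proof (rule summable_sums, rule summable_comparison_test'[where N = 0])
  have "2 powr (-\<beta>) < (1 :: real)"
    using \<beta> by (auto intro: powr_less_one)
  then show "summable (\<lambda>k. (2 powr (-\<beta>) :: real) ^ Suc k)"
    unfolding summable_Suc_iff by (intro summable_geometric) simp
  show "norm ((2 powr (-\<beta>)) ^ k' * signed_tents (e k) (2 ^ k * t)) \<le> (2 powr (-\<beta>)) ^ k'" for k k'
    using mult_left_le[OF tent_row_bounded[of k "2 ^ k * t"], of "(2 powr (-\<beta>)) ^ k'"]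
    by (simp add: abs_mult)
qed

lemma tent_series_of_nat: "tent_series \<beta> e (real n) = 0"
proof -
  have "signed_tents (e k) (2 ^ k * real n) = 0" for k
    using signed_tents_of_nat[of "e k" "2 ^ k * n"] by simp
  then show ?thesis
    by (simp add: tent_series_def)
qed

lemma midpoint_deviation_tent_series:
  "midpoint_deviation (tent_series \<beta> e) j m = (2 powr (-\<beta>)) ^ Suc j * e j m"
proof -
  let ?c = "\<lambda>k. (2 powr (-\<beta>) :: real) ^ Suc k"
  let ?row = "\<lambda>k t. signed_tents (e k) (2 ^ k * t)"
  have "(\<lambda>k. ?c k * ?row k (dyadic_point (Suc j) (Suc (2 * m)))
      - (?c k * ?row k (dyadic_point j m) + ?c k * ?row k (dyadic_point j (Suc m))) / 2)
      sums midpoint_deviation (tent_series \<beta> e) j m"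
    unfolding midpoint_deviation_def by (intro sums_diff sums_add sums_divide tent_series_sums)
  also have "(\<lambda>k. ?c k * ?row k (dyadic_point (Suc j) (Suc (2 * m)))
      - (?c k * ?row k (dyadic_point j m) + ?c k * ?row k (dyadic_point j (Suc m))) / 2)
      = (\<lambda>k. ?c k * midpoint_deviation (?row k) j m)"
    by (simp add: midpoint_deviation_def fun_eq_iff algebra_simps)
  also have "\<dots> = (\<lambda>k. if k = j then ?c k * e k m else 0)"
    by (simp add: midpoint_deviation_signed_tents fun_eq_iff)
  finally show ?thesis
    using sums_single[of j "\<lambda>k. ?c k * e k m"] by (rule sums_unique2)
qed

text \<open>Row $k$ contributes to the difference of two values at distance $\delta$ at most its
  amplitude, of order $r^k$ with $r = 2^{-\beta}$, and at most its slope times $\delta$, of order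
  $R^k\delta$ with $R = 2r$. For $0 < \beta < 1$ one has $r < 1 < R$, so cutting the series at the
  scale $2^{-K} \approx \delta$ leaves two geometric sums, each dominated by its terms near $K$,
  where both bounds are of order $r^K \approx \delta^\beta$.\<close>

lemma tent_series_holder:
  assumes "\<beta> < 1"
  shows "tent_series \<beta> e \<in> holder_class \<beta>"
proof -
  define r R where "r = (2 powr (-\<beta>) :: real)" and "R = 2 * r"
  have r: "0 < r" "r < 1"
    using \<beta> by (auto simp: r_def intro: powr_less_one)
  have "R = 2 powr (1 - \<beta>)"
    by (simp add: R_def r_def powr_diff powr_minus divide_inverse)
  then have R: "1 < R"
    using \<open>\<beta> < 1\<close> by simp
  define C where "C = (R\<^sup>2 / (R - 1) + 2 * r\<^sup>2 / (1 - r)) / r"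
  have "0 \<le> C"
    using r R by (simp add: C_def)
  have "\<bar>tent_series \<beta> e s - tent_series \<beta> e t\<bar> \<le> C * \<bar>s - t\<bar> powr \<beta>"
    if st: "s \<in> {0..1}" "t \<in> {0..1}" for s t
  proof (cases "s = t")
    case False
    define \<delta> where "\<delta> = \<bar>s - t\<bar>"
    have \<delta>: "0 < \<delta>" "\<delta> \<le> 1"
      using False st by (auto simp: \<delta>_def)
    obtain K where K: "2 ^ K * \<delta> \<le> 1" "1 < 2 ^ Suc K * \<delta>"
    proof -
      have ex: "\<exists>n. 1 < 2 ^ n * \<delta>"
        using real_arch_pow[of 2 "1 / \<delta>"] \<delta> by (auto simp: field_simps)
      define n where "n = (LEAST n. 1 < 2 ^ n * \<delta>)"
      have n: "1 < 2 ^ n * \<delta>"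
        unfolding n_def using ex by (rule LeastI_ex)
      with \<delta> have "n \<noteq> 0" by (intro notI) simp
      then obtain K where nK: "n = Suc K" by (cases n) auto
      have "\<not> 1 < 2 ^ K * \<delta>"
        using nK not_less_Least[of K "\<lambda>n. 1 < 2 ^ n * \<delta>"] by (simp add: n_def)
      with n nK show ?thesis by (intro that[of K]) auto
    qed
    define u where "u k = r ^ Suc k * (signed_tents (e k) (2 ^ k * s) - signed_tents (e k) (2 ^ k * t))" for k
    have usums: "u sums (tent_series \<beta> e s - tent_series \<beta> e t)"
      using sums_diff[OF tent_series_sums[of s] tent_series_sums[of t]]
      unfolding u_def r_def by (simp only: right_diff_distrib)
    have u1: "\<bar>u k\<bar> \<le> 2 * r ^ Suc k" for k
    proof -
      have "\<bar>signed_tents (e k) (2 ^ k * s) - signed_tents (e k) (2 ^ k * t)\<bar> \<le> 2"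
        using tent_row_bounded[of k "2 ^ k * s"] tent_row_bounded[of k "2 ^ k * t"]
        by linarith
      then show ?thesis
        using r mult_left_mono[of _ 2 "r ^ Suc k"] by (simp only: u_def abs_mult) (simp add: mult.commute)
    qed
    have u2: "\<bar>u k\<bar> \<le> \<delta> * R ^ Suc k" for k
    proof -
      have "\<bar>signed_tents (e k) (2 ^ k * s) - signed_tents (e k) (2 ^ k * t)\<bar> \<le> 2 * \<bar>2 ^ k * s - 2 ^ k * t\<bar>"
        using st by (intro signed_tents_lipschitz e) auto
      also have "\<dots> = 2 ^ Suc k * \<delta>"
        by (simp add: \<delta>_def abs_mult flip: right_diff_distrib)
      finally have "\<bar>u k\<bar> \<le> r ^ Suc k * (2 ^ Suc k * \<delta>)"
        unfolding u_def abs_mult using r by (simp add: mult_left_mono)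
      then show ?thesis
        by (simp add: R_def power_mult_distrib mult_ac)
    qed
    have tail: "(\<lambda>k. 2 * r ^ Suc (k + Suc K)) sums (2 * r\<^sup>2 / (1 - r) * r ^ K)"
      using sums_mult[OF geometric_sums[of r], of "2 * r\<^sup>2 * r ^ K"] r
      by (simp add: power_add power2_eq_square mult_ac)
    have ush: "summable (\<lambda>k. \<bar>u (k + Suc K)\<bar>)"
      by (rule summable_comparison_test'[OF sums_summable[OF tail], where N = 0]) (simp only: real_norm_def abs_abs u1)
    have "tent_series \<beta> e s - tent_series \<beta> e t = (\<Sum>k. u (k + Suc K)) + (\<Sum>k<Suc K. u k)"
      using usums by (metis sums_unique sums_summable suminf_split_initial_segment)
    moreover have "\<bar>\<Sum>k. u (k + Suc K)\<bar> \<le> 2 * r\<^sup>2 / (1 - r) * r ^ K"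
    proof -
      have "\<bar>\<Sum>k. u (k + Suc K)\<bar> \<le> (\<Sum>k. \<bar>u (k + Suc K)\<bar>)"
        by (rule summable_rabs[OF ush])
      also have "\<dots> \<le> 2 * r\<^sup>2 / (1 - r) * r ^ K"
        using suminf_le[OF u1 ush sums_summable[OF tail]] sums_unique[OF tail] by simp
      finally show ?thesis .
    qed
    moreover have "\<bar>\<Sum>k<Suc K. u k\<bar> \<le> R\<^sup>2 / (R - 1) * r ^ K"
    proof -
      have "\<bar>\<Sum>k<Suc K. u k\<bar> \<le> (\<Sum>k<Suc K. \<delta> * R ^ Suc k)"
        by (intro order_trans[OF sum_abs] sum_mono u2)
      also have "\<dots> = \<delta> * R * (\<Sum>k<Suc K. R ^ k)"
        unfolding sum_distrib_left by (simp only: power_Suc mult.assoc)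
      also have "\<dots> = \<delta> * R * ((R ^ Suc K - 1) / (R - 1))"
        using R geometric_sum[of R "Suc K"] by simp
      also have "\<dots> \<le> \<delta> * R * (R ^ Suc K / (R - 1))"
        using R \<delta> by (intro mult_left_mono divide_right_mono) auto
      also have "\<dots> = R\<^sup>2 / (R - 1) * r ^ K * (2 ^ K * \<delta>)"
        by (simp add: R_def power_mult_distrib power2_eq_square)
      also have "\<dots> \<le> R\<^sup>2 / (R - 1) * r ^ K"
        using K R r by (intro mult_left_le) auto
      finally show ?thesis .
    qed
    ultimately have "\<bar>tent_series \<beta> e s - tent_series \<beta> e t\<bar>
        \<le> (R\<^sup>2 / (R - 1) + 2 * r\<^sup>2 / (1 - r)) * r ^ K"
      unfolding distrib_right by linarith
    also have "\<dots> = C * r ^ Suc K"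
      using r by (simp add: C_def)
    also have "r ^ Suc K \<le> \<delta> powr \<beta>"
    proof -
      have "1 / 2 ^ Suc K \<le> \<delta>"
        using K by (simp add: field_simps)
      then have "(1 / 2 ^ Suc K) powr \<beta> \<le> \<delta> powr \<beta>"
        using \<beta> by (intro powr_mono2) auto
      then show ?thesis
        unfolding dyadic_length_powr r_def .
    qed
    finally show ?thesis
      using \<open>0 \<le> C\<close> by (simp add: mult_left_mono \<delta>_def)
  qed simp
  with \<open>0 \<le> C\<close> show ?thesis
    unfolding holder_class_iff by blast
qed

end

text \<open>On the whole unit interval every level uses all its interior points, and the boundary terms
  disappear with the end values of $f$.\<close>

lemma jump_sum_eq_detail_sum:
  assumes g: "continuous_on {0..1} g" and f: "f 0 = 0" "f 1 = 0"
  shows "jump_sum f g k 0 (2 ^ k) =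
    (\<Sum>j<k. \<Sum>m<2 ^ j. dyadic_detail g j m * midpoint_deviation f j m)"
proof (induction k)
  case 0
  have "{0<..<Suc 0} = {}" by auto
  then show ?case by (simp add: jump_sum_def)
next
  case (Suc k)
  have "dyadic_point k 0 = 0" "dyadic_point k (2 ^ k) = 1"
    by (simp_all add: dyadic_point_def)
  then show ?case
    using jump_sum_refine[OF g, of 0 "2 ^ k" k f] Suc f by (simp add: lessThan_atLeast0)
qed

text \<open>The signs of the details as Faber--Schauder signs make the increment of level $k$ equal to
  the $k$-th term of the series.\<close>

lemma summable_if_dyadic_integral_exists:
  assumes "0 < \<alpha>" "0 < \<beta>" "\<beta> < 1" and g: "g \<in> holder_class \<alpha>"
    and ex: "\<And>f. f \<in> holder_class \<beta> \<Longrightarrow> dyadic_integral_exists f g 0 1"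
  shows "summable (\<lambda>k. 2 powr (real (k + 1) * (1 - \<beta>)) * dyadic_area g k)"
proof -
  let ?w = "\<lambda>k. 2 powr (real (k + 1) * (1 - \<beta>)) * dyadic_area g k"
  define e where "e k m = sgn (dyadic_detail g k m)" for k m
  define f where "f = tent_series \<beta> e"
  have e: "\<bar>e k m\<bar> \<le> 1" for k m
    by (simp add: e_def abs_sgn_eq)
  have f0: "f 0 = 0" "f 1 = 0"
    using tent_series_of_nat[of \<beta> e 0] tent_series_of_nat[of \<beta> e 1] \<open>0 < \<beta>\<close> e
    by (simp_all add: f_def)
  have "(\<Sum>m<2 ^ j. dyadic_detail g j m * midpoint_deviation f j m) = ?w j" for j
  proof -
    have "dyadic_detail g j m * midpoint_deviation f j m
        = (2 powr (-\<beta>)) ^ Suc j * \<bar>dyadic_detail g j m\<bar>" for m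
      unfolding f_def using midpoint_deviation_tent_series[of \<beta> e j m] \<open>0 < \<beta>\<close> e
      by (simp add: e_def abs_sgn mult_ac)
    then show ?thesis
      unfolding weight_eq mult.assoc dyadic_area_eq by (simp only: sum_distrib_left)
  qed
  then have S: "dyadic_sum f g 0 1 (Suc k) = (\<Sum>j<Suc k. ?w j)" for k
    using jump_sum_eq_detail_sum[OF holder_imp_continuous_on[OF \<open>0 < \<alpha>\<close> g] f0, of "Suc k"]
    by (simp add: dyadic_sum_Suc nat_power_eq)
  have "f \<in> holder_class \<beta>"
    unfolding f_def using assms e by (intro tent_series_holder) auto
  then obtain I where "dyadic_sum f g 0 1 \<longlonglongrightarrow> I"
    using ex unfolding dyadic_integral_exists_def has_dyadic_integral_def by blast
  then have "(\<lambda>k. \<Sum>j<Suc k. ?w j) \<longlonglongrightarrow> I"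
    using LIMSEQ_Suc[of "dyadic_sum f g 0 1" I] unfolding S by blast
  then have "?w sums I"
    unfolding sums_def by (rule LIMSEQ_imp_Suc)
  then show ?thesis
    by (rule sums_summable)
qed

theorem theorem2p2:
  fixes \<alpha> \<beta> :: real and g :: "real \<Rightarrow> real"
  assumes "0 < \<alpha>" and "\<alpha> < 1" and "0 < \<beta>" and "\<beta> < 1"
    and "g \<in> holder_class \<alpha>"
  shows "(\<forall>f \<in> holder_class \<beta>. \<forall>a b. 0 \<le> a \<and> a < b \<and> b \<le> 1 \<longrightarrow> dyadic_integral_exists f g a b)
    \<longleftrightarrow> summable (\<lambda>k. 2 powr (real (k + 1) * (1 - \<beta>)) * dyadic_area g k)"
proof
  assume "\<forall>f \<in> holder_class \<beta>. \<forall>a b. 0 \<le> a \<and> a < b \<and> b \<le> 1 \<longrightarrow> dyadic_integral_exists f g a b"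
  then show "summable (\<lambda>k. 2 powr (real (k + 1) * (1 - \<beta>)) * dyadic_area g k)"
    using assms by (intro summable_if_dyadic_integral_exists[of \<alpha>]) auto
next
  assume "summable (\<lambda>k. 2 powr (real (k + 1) * (1 - \<beta>)) * dyadic_area g k)"
  then show "\<forall>f \<in> holder_class \<beta>. \<forall>a b. 0 \<le> a \<and> a < b \<and> b \<le> 1 \<longrightarrow> dyadic_integral_exists f g a b"
    using assms by (blast intro: dyadic_integral_exists_if_summable)
qed

end
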